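(* Let $1\leq p<\infty$. Then $\ell^p$ has maximal roundness $\min(p,p')$, i.e. $\mathrm{mr}(\ell^p)=\min(p,p')$.
   Context: All Banach spaces are real; $\ell^p$ is the usual space of $p$-summable real sequences. $p'$ is the conjugate index, $\frac1p+\frac1{p'}=1$, with the convention $p'=\infty$ if $p=1$. A metric space $(X,d)$ has roundness $p\geq 1$ if for all $a_1,a_2,b_1,b_2\in X$, $d(a_1,a_2)^p+d(b_1,b_2)^p\leq\sum_{1\leq i,j\leq 2}d(a_i,b_j)^p$. For a Banach space $X$ this is equivalent (Enflo) to $\|x+y\|^p+\|x-y\|^p\leq 2(\|x\|^p+\|y\|^p)$ for all $x,y\in X$. The maximal roundness of a Banach space $X$ is $\mathrm{mr}(X)=\sup\{p\geq 1: X\text{ has roundness }p\}$. *)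

theory Defs
  imports "HOL-Analysis.Analysis"
begin

definition has_roundness :: "'a metric \<Rightarrow> real \<Rightarrow> bool" where
  "has_roundness X q \<longleftrightarrow> 1 \<le> q \<and>
    (\<forall>a1\<in>mspace X. \<forall>a2\<in>mspace X. \<forall>b1\<in>mspace X. \<forall>b2\<in>mspace X.
      mdist X a1 a2 powr q + mdist X b1 b2 powr q
        \<le> mdist X a1 b1 powr q + mdist X a1 b2 powr q + mdist X a2 b1 powr q + mdist X a2 b2 powr q)"

text \<open>The supremum is taken in \<^typ>\<open>ereal\<close>, since the roundness exponents of a metric space
  (for instance of an ultrametric space) may be unbounded.\<close>

definition maximal_roundness :: "'a metric \<Rightarrow> ereal" where
  "maximal_roundness X = Sup (ereal ` {q. has_roundness X q})"

definition conjugate_index :: "real \<Rightarrow> ereal" where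
  "conjugate_index p = (if p = 1 then \<infinity> else ereal (p / (p - 1)))"

lemma conjugate_index_iff:
  assumes "1 \<le> p" "1 \<le> q"
  shows "q = conjugate_index p \<longleftrightarrow> 1 / ereal p + 1 / q = 1"
  using assms
  by (cases q) (auto simp: conjugate_index_def one_ereal_def field_simps)

definition lp_space :: "real \<Rightarrow> (nat \<Rightarrow> real) set" where
  "lp_space p = {x. summable (\<lambda>n. \<bar>x n\<bar> powr p)}"

definition lp_norm :: "real \<Rightarrow> (nat \<Rightarrow> real) \<Rightarrow> real" where
  "lp_norm p x = (\<Sum>n. \<bar>x n\<bar> powr p) powr (1 / p)"

definition lp_metric :: "real \<Rightarrow> (nat \<Rightarrow> real) metric" where
  "lp_metric p = metric (lp_space p, \<lambda>x y. lp_norm p (\<lambda>n. x n - y n))"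

text \<open>The constructor \<^const>\<open>metric\<close> is only meaningful on an actual metric space; the rest of
  the theory checks this for \<^term>\<open>p \<ge> 1\<close>.\<close>

lemma powr_convex_nonneg:
  fixes a b u v p :: real
  assumes "1 \<le> p" "0 \<le> a" "0 \<le> b" "0 \<le> u" "0 \<le> v" "u + v = 1"
  shows "(u * a + v * b) powr p \<le> u * a powr p + v * b powr p"
proof -
  have scale: "(w * c) powr p \<le> w * c powr p" if "0 \<le> w" "w \<le> 1" "0 \<le> c" for w c :: real
  proof -
    have "w powr p \<le> w"
      using that \<open>1 \<le> p\<close> powr_mono'[of 1 p w] by (cases "w = 0") auto
    then show ?thesis
      using that by (simp add: powr_mult mult_right_mono)
  qed
  consider "a = 0" | "b = 0" | "0 < a" "0 < b"
    using assms by linarith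
  then show ?thesis
  proof cases
    case 1
    then show ?thesis using scale[of v b] assms by simp
  next
    case 2
    then show ?thesis using scale[of u a] assms by simp
  next
    case 3
    have u: "u = 1 - v"
      using assms by simp
    show ?thesis
      unfolding u using 3 assms convex_onD[OF powr_convex[OF \<open>1 \<le> p\<close>], of v a b] by simp
  qed
qed

lemma lp_norm_nonneg: "0 \<le> lp_norm p x"
  by (simp add: lp_norm_def)

lemma lp_norm_powr:
  assumes "1 \<le> p" "x \<in> lp_space p"
  shows "lp_norm p x powr p = (\<Sum>n. \<bar>x n\<bar> powr p)"
  using assms by (simp add: lp_norm_def lp_space_def powr_powr suminf_nonneg)

lemma lp_norm_eq_0_iff:
  assumes "1 \<le> p" "x \<in> lp_space p"
  shows "lp_norm p x = 0 \<longleftrightarrow> x = (\<lambda>n. 0)"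
  using assms suminf_eq_zero_iff[of "\<lambda>n. \<bar>x n\<bar> powr p"]
  by (auto simp: lp_norm_def lp_space_def)

lemma lp_space_add:
  assumes p: "1 \<le> p" and x: "x \<in> lp_space p" and y: "y \<in> lp_space p"
  shows "(\<lambda>n. x n + y n) \<in> lp_space p"
    and "lp_norm p (\<lambda>n. x n + y n) \<le> lp_norm p x + lp_norm p y"
proof -
  let ?s = "lp_norm p x" and ?t = "lp_norm p y"
  have "(\<lambda>n. x n + y n) \<in> lp_space p \<and> lp_norm p (\<lambda>n. x n + y n) \<le> ?s + ?t"
  proof (cases "?s = 0 \<or> ?t = 0")
    case True
    then show ?thesis
      using lp_norm_eq_0_iff[OF p x] lp_norm_eq_0_iff[OF p y] x y by auto
  next
    case False
    then have s: "0 < ?s" and t: "0 < ?t"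
      using lp_norm_nonneg[of p x] lp_norm_nonneg[of p y] by linarith+
    define N where "N = ?s + ?t"
    have N: "0 < N" using s t by (simp add: N_def)
    define B where "B n = N powr p * (?s / N * (\<bar>x n\<bar> powr p / ?s powr p)
      + ?t / N * (\<bar>y n\<bar> powr p / ?t powr p))" for n
    have le: "\<bar>x n + y n\<bar> powr p \<le> B n" for n
    proof -
      have "\<bar>x n + y n\<bar> powr p \<le> (\<bar>x n\<bar> + \<bar>y n\<bar>) powr p"
        using p by (intro powr_mono2) auto
      also have "\<bar>x n\<bar> + \<bar>y n\<bar> = N * (?s / N * (\<bar>x n\<bar> / ?s) + ?t / N * (\<bar>y n\<bar> / ?t))"
        using N s t by (simp add: distrib_left)
      also have "\<dots> powr p = N powr p * (?s / N * (\<bar>x n\<bar> / ?s) + ?t / N * (\<bar>y n\<bar> / ?t)) powr p"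
        using N s t by (intro powr_mult)
      also have "\<dots> \<le> N powr p * (?s / N * (\<bar>x n\<bar> / ?s) powr p + ?t / N * (\<bar>y n\<bar> / ?t) powr p)"
      proof (intro mult_left_mono powr_convex_nonneg p)
        show "?s / N + ?t / N = 1"
          using N by (simp add: N_def add_divide_distrib[symmetric])
      qed (use N s t in auto)
      also have "\<dots> = B n"
        using s t by (simp add: B_def powr_divide)
      finally show ?thesis .
    qed
    have sx: "(\<lambda>n. \<bar>x n\<bar> powr p) sums (?s powr p)"
      using x lp_norm_powr[OF p x] by (simp add: lp_space_def summable_sums)
    have sy: "(\<lambda>n. \<bar>y n\<bar> powr p) sums (?t powr p)"
      using y lp_norm_powr[OF p y] by (simp add: lp_space_def summable_sums)
    have "B sums (N powr p * (?s / N * (?s powr p / ?s powr p) + ?t / N * (?t powr p / ?t powr p)))"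
      unfolding B_def by (intro sums_mult sums_add sums_divide sx sy)
    also have "N powr p * (?s / N * (?s powr p / ?s powr p) + ?t / N * (?t powr p / ?t powr p)) = N powr p"
    proof -
      have "?s / N + ?t / N = 1"
        using N by (simp add: N_def add_divide_distrib[symmetric])
      then show ?thesis using s t by simp
    qed
    finally have B: "B sums (N powr p)" .
    have sum: "summable (\<lambda>n. \<bar>x n + y n\<bar> powr p)"
      by (rule summable_comparison_test'[OF sums_summable[OF B], of 0]) (use le in auto)
    have "(\<Sum>n. \<bar>x n + y n\<bar> powr p) \<le> N powr p"
      using suminf_le[OF le sum sums_summable[OF B]] sums_unique[OF B] by simp
    then have "lp_norm p (\<lambda>n. x n + y n) \<le> (N powr p) powr (1 / p)"
      unfolding lp_norm_def using p sum by (intro powr_mono2) (auto simp: suminf_nonneg)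
    also have "\<dots> = ?s + ?t"
      using p N by (simp add: powr_powr N_def)
    finally show ?thesis
      using sum by (simp add: lp_space_def)
  qed
  then show "(\<lambda>n. x n + y n) \<in> lp_space p"
    and "lp_norm p (\<lambda>n. x n + y n) \<le> lp_norm p x + lp_norm p y"
    by auto
qed

lemma lp_space_diff:
  assumes "1 \<le> p" "x \<in> lp_space p" "y \<in> lp_space p"
  shows "(\<lambda>n. x n - y n) \<in> lp_space p"
  using lp_space_add(1)[of p x "\<lambda>n. - y n"] assms by (simp add: lp_space_def)

lemma Metric_space_lp:
  assumes p: "1 \<le> p"
  shows "Metric_space (lp_space p) (\<lambda>x y. lp_norm p (\<lambda>n. x n - y n))"
proof
  fix x y z :: "nat \<Rightarrow> real"
  show "0 \<le> lp_norm p (\<lambda>n. x n - y n)"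
    by (rule lp_norm_nonneg)
  show "lp_norm p (\<lambda>n. x n - y n) = lp_norm p (\<lambda>n. y n - x n)"
    by (simp add: lp_norm_def abs_minus_commute)
  assume x: "x \<in> lp_space p" and y: "y \<in> lp_space p"
  show "lp_norm p (\<lambda>n. x n - y n) = 0 \<longleftrightarrow> x = y"
    using lp_norm_eq_0_iff[OF p lp_space_diff[OF p x y]] by (auto simp: fun_eq_iff)
  assume z: "z \<in> lp_space p"
  show "lp_norm p (\<lambda>n. x n - z n) \<le> lp_norm p (\<lambda>n. x n - y n) + lp_norm p (\<lambda>n. y n - z n)"
    using lp_space_add(2)[OF p lp_space_diff[OF p x y] lp_space_diff[OF p y z]] by simp
qed

lemma mspace_lp_metric [simp]: "1 \<le> p \<Longrightarrow> mspace (lp_metric p) = lp_space p"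
  by (simp add: lp_metric_def Metric_space.mspace_metric[OF Metric_space_lp])

lemma mdist_lp_metric [simp]:
  "1 \<le> p \<Longrightarrow> mdist (lp_metric p) x y = lp_norm p (\<lambda>n. x n - y n)"
  by (simp add: lp_metric_def Metric_space.mdist_metric[OF Metric_space_lp])

end

theory Submission
  imports Defs
begin

text \<open>
  In terms of the norm \<open>N\<close> of \<open>\<ell>\<^sup>p\<close>, the four-point condition for the exponent \<open>q\<close> follows from
  Enflo's two-vector inequality \<open>N(x + y)\<^sup>q + N(x - y)\<^sup>q \<le> 2 (N(x)\<^sup>q + N(y)\<^sup>q)\<close> and the
  convexity of \<open>N\<^sup>q\<close> (\<open>has_roundness_lpI\<close>).

  For \<open>p \<le> 2\<close> and \<open>q = p\<close> this inequality can be checked coordinatewise (\<open>scalar_enflo\<close>).  On the real line it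
  says that replacing the parallelogram law by exponents below \<open>2\<close> only loses: the quadratic mean
  of \<open>x + y\<close> and \<open>x - y\<close> is \<open>sqrt (x\<^sup>2 + y\<^sup>2)\<close>, the mean of order \<open>p\<close> is at most that, and the
  \<open>\<ell>\<^sup>p\<close>-norm of the pair \<open>(x, y)\<close> is at least that.

  For \<open>p \<ge> 2\<close> and \<open>q = p'\<close> the coordinates are measured with the wrong exponent.  What is used
  on the real line is Clarkson's inequality
  \<open>\<bar>x + y\<bar>\<^sup>p + \<bar>x - y\<bar>\<^sup>p \<le> 2 (\<bar>x\<bar>\<^sup>q + \<bar>y\<bar>\<^sup>q)\<^sup>p\<^sup>-\<^sup>1\<close>, the Hausdorff--Young inequality for the group of
  order two (\<open>scalar_clarkson\<close>).  As \<open>p - 1 = p / q \<ge> 1\<close>, Minkowski's inequality with exponent \<open>p - 1\<close>, applied to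
  the sequences \<open>\<bar>x n\<bar>\<^sup>q\<close> and \<open>\<bar>y n\<bar>\<^sup>q\<close>, carries it over to \<open>\<ell>\<^sup>p\<close>, and comparing the means of
  order \<open>q\<close> and \<open>p\<close> gives Enflo's inequality (\<open>lp_enflo_ge_2\<close>).  Clarkson's inequality itself is read off from the
  binomial series: when the terms of the difference of its two sides are grouped in pairs, each
  pair is nonnegative by the weighted inequality of the arithmetic and geometric means
  (\<open>paired_terms_le\<close>).

  Conversely two squares in the plane of the first two coordinates bound the roundness: the square
  with vertices \<open>0\<close>, \<open>e\<^sub>1\<close>, \<open>e\<^sub>1 + e\<^sub>2\<close>, \<open>e\<^sub>2\<close> allows no exponent above \<open>p\<close>, and the
  square rotated by \<open>45\<close> degrees none above \<open>p'\<close>.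
\<close>

section \<open>Means of two nonnegative numbers\<close>

lemma power_mean_le:
  fixes s t a b :: real
  assumes "0 < a" "a \<le> b" "0 \<le> s" "0 \<le> t"
  shows "(s powr a + t powr a) / 2 \<le> ((s powr b + t powr b) / 2) powr (a / b)"
proof -
  let ?m = "(s powr a + t powr a) / 2"
  have "(1/2 * s powr a + 1/2 * t powr a) powr (b / a)
      \<le> 1/2 * (s powr a) powr (b / a) + 1/2 * (t powr a) powr (b / a)"
    using assms by (intro powr_convex_nonneg) auto
  then have "?m powr (b / a) \<le> (s powr b + t powr b) / 2"
    using assms by (simp add: powr_powr add_divide_distrib)
  then have "(?m powr (b / a)) powr (a / b) \<le> ((s powr b + t powr b) / 2) powr (a / b)"
    using assms by (intro powr_mono2) auto
  then show ?thesis
    using assms by (simp add: powr_powr)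
qed

text \<open>
  Both terms on the right are compared with the share of \<open>(s + t)\<^sup>a\<close> belonging to them: a number
  in the unit interval does not decrease when it is raised to a power \<open>a \<le> 1\<close>.
\<close>

lemma powr_subadditive:
  fixes s t a :: real
  assumes "0 < a" "a \<le> 1" "0 \<le> s" "0 \<le> t"
  shows "(s + t) powr a \<le> s powr a + t powr a"
proof (cases "s + t = 0")
  case False
  define N where "N = s + t"
  have N: "0 < N" using False assms by (simp add: N_def)
  have *: "w / N * N powr a \<le> w powr a" if "0 \<le> w" "w \<le> N" for w
  proof -
    have "w / N \<le> (w / N) powr a"
      using that N assms powr_mono'[of a 1 "w / N"] by (cases "w = 0") auto
    then have "w / N * N powr a \<le> (w / N) powr a * N powr a"
      by (intro mult_right_mono) auto
    then show ?thesis using that N by (simp add: powr_divide)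
  qed
  have "N powr a = s / N * N powr a + t / N * N powr a"
    using N by (simp add: N_def[symmetric] flip: distrib_right add_divide_distrib)
  also have "\<dots> \<le> s powr a + t powr a"
    using assms by (intro add_mono *) (auto simp: N_def)
  finally show ?thesis by (simp add: N_def)
qed (use assms in auto)

section \<open>Scalar inequalities\<close>

text \<open>
  The parallelogram law computes the quadratic mean of \<open>\<bar>x + y\<bar>\<close> and \<open>\<bar>x - y\<bar>\<close>.  The mean of order
  \<open>p\<close> is at most the quadratic one, and the exponent \<open>p / 2 \<le> 1\<close> is subadditive.
\<close>

lemma scalar_enflo:
  fixes x y p :: real
  assumes "1 \<le> p" "p \<le> 2"
  shows "\<bar>x + y\<bar> powr p + \<bar>x - y\<bar> powr p \<le> 2 * (\<bar>x\<bar> powr p + \<bar>y\<bar> powr p)"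
proof -
  have "(\<bar>x + y\<bar> powr p + \<bar>x - y\<bar> powr p) / 2
      \<le> ((\<bar>x + y\<bar> powr 2 + \<bar>x - y\<bar> powr 2) / 2) powr (p / 2)"
    using assms by (intro power_mean_le) auto
  also have "(\<bar>x + y\<bar> powr 2 + \<bar>x - y\<bar> powr 2) / 2 = x\<^sup>2 + y\<^sup>2"
    by (simp add: power2_eq_square algebra_simps)
  also have "(x\<^sup>2 + y\<^sup>2) powr (p / 2) \<le> (x\<^sup>2) powr (p / 2) + (y\<^sup>2) powr (p / 2)"
    using assms by (intro powr_subadditive) auto
  also have "\<dots> = (\<bar>x\<bar> powr 2) powr (p / 2) + (\<bar>y\<bar> powr 2) powr (p / 2)"
    by simp
  also have "\<dots> = \<bar>x\<bar> powr p + \<bar>y\<bar> powr p"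
    by (simp only: powr_powr) simp
  finally show ?thesis by simp
qed

text \<open>
  For \<open>q - 1\<close> in the unit interval, the binomial coefficients alternate in sign after the first two:
  going from an odd index to the next odd one multiplies by two nonpositive factors.
\<close>

lemma gbinomial_odd_nonneg:
  fixes q :: real
  assumes "1 \<le> q" "q \<le> 2"
  shows "0 \<le> (q - 1) gchoose Suc (2 * n)"
proof (induction n)
  case 0
  then show ?case using assms by simp
next
  case (Suc n)
  define a where "a = q - 1"
  have step: "a gchoose Suc k = (a gchoose k) * ((a - k) / Suc k)" for k
    using gbinomial_mult_1[of a k] by (simp add: field_simps del: of_nat_Suc)
  have "a gchoose Suc (2 * Suc n) = (a gchoose Suc (2 * n))
      * (((a - Suc (2 * n)) / Suc (Suc (2 * n))) * ((a - Suc (Suc (2 * n))) / Suc (Suc (Suc (2 * n)))))"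
    using step[of "Suc (Suc (2*n))"] step[of "Suc (2*n)"] by (simp add: mult.assoc)
  moreover have "0 \<le> ((a - Suc (2 * n)) / Suc (Suc (2 * n))) * ((a - Suc (Suc (2 * n))) / Suc (Suc (Suc (2 * n))))"
    using assms by (intro mult_nonpos_nonpos divide_nonpos_pos) (auto simp: a_def)
  ultimately show ?case
    using Suc by (simp only: a_def mult_nonneg_nonneg)
qed

text \<open>
  One pair of terms in the comparison of the series of \<open>(1 + t\<^sup>p)\<^sup>q\<^sup>-\<^sup>1\<close> with the even part of the
  series of \<open>(1 + t)\<^sup>q\<close>.  All three coefficients contain the nonnegative factor
  \<open>(q - 1) gchoose (m - 1)\<close>; what remains is the weighted inequality of the means for \<open>t\<^sup>m\<close> and
  \<open>t\<^sup>p\<^sup>m\<close> with weights \<open>q / m\<close> and \<open>(m - q) / m\<close>; conjugacy, in the form \<open>p (q - 1) = q\<close>, makes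
  \<open>t\<^sup>p\<^sup>(\<^sup>m\<^sup>-\<^sup>1\<^sup>)\<close> their geometric mean.
\<close>

lemma paired_terms_le:
  fixes p q t :: real and m n :: nat
  assumes q: "1 < q" "q \<le> 2" and p: "p * (q - 1) = q" and t: "0 < t"
    and m_def: "m = Suc (Suc (2 * n))"
  shows "((q - 1) gchoose Suc (2 * n)) * (t powr p) ^ Suc (2 * n) + ((q - 1) gchoose m) * (t powr p) ^ m
    \<le> (q gchoose m) * t ^ m"
proof -
  define A where "A = (q - 1) gchoose Suc (2 * n)"
  have A: "0 \<le> A"
    unfolding A_def using q by (intro gbinomial_odd_nonneg) auto
  have m: "2 \<le> real m" "real (Suc (2 * n)) = real m - 1"
    by (simp_all add: m_def)
  have "real m * (q gchoose m) = q * A"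
    using gbinomial_absorption[of "Suc (2 * n)" q] by (simp add: m_def A_def)
  then have c1: "q gchoose m = A * (q / m)"
    using m by (simp add: field_simps)
  have "q gchoose m = A + ((q - 1) gchoose m)"
    using gbinomial_Suc_Suc[of "q - 1" "Suc (2 * n)"] by (simp add: m_def A_def)
  then have c2: "(q - 1) gchoose m = - A * ((m - q) / m)"
    using c1 m by (simp add: field_simps)
  have "(t powr m) powr (q / m) * (t powr (p * m)) powr ((m - q) / m)
      \<le> q / m * t powr m + (m - q) / m * t powr (p * m)"
    using q t m by (intro Youngs_inequality_0) (auto simp: field_simps)
  also have "(t powr m) powr (q / m) * (t powr (p * m)) powr ((m - q) / m) = t powr (p * (real m - 1))"
  proof -
    have "q + p * (m - q) = p * (real m - 1)"
      using p by (simp add: algebra_simps)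
    then show ?thesis
      using m t by (simp add: powr_powr powr_add[symmetric])
  qed
  finally have "A * t powr (p * (real m - 1)) \<le> A * (q / m * t powr m + (m - q) / m * t powr (p * m))"
    using A by (rule mult_left_mono)
  moreover have "t powr (p * (real m - 1)) = (t powr p) ^ Suc (2 * n)"
    unfolding m(2)[symmetric] powr_powr[symmetric] using t by (intro powr_realpow) simp
  moreover have "t powr m = t ^ m" "t powr (p * m) = (t powr p) ^ m"
    unfolding powr_powr[symmetric] using t by (intro powr_realpow; simp)+
  ultimately show ?thesis
    by (simp only: c1 c2 A_def[symmetric]) (simp only: algebra_simps)
qed

text \<open>
  Both sides are expanded by the binomial series, on the right only even powers of \<open>t\<close> survive, and
  the constant terms agree.  The remaining terms with indices \<open>2 n + 1\<close> and \<open>2 n + 2\<close> are compared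
  together: the left series alternates in sign, so a comparison of single terms would fail.
\<close>

lemma clarkson_unit_interval:
  fixes p q t :: real
  assumes q: "1 < q" "q \<le> 2" and p: "p * (q - 1) = q" and t: "0 \<le> t" "t \<le> 1"
  shows "(1 + t powr p) powr (q - 1) \<le> ((1 + t) powr q + (1 - t) powr q) / 2"
proof -
  consider "t = 0" | "t = 1" | "0 < t" "t < 1"
    using t by linarith
  then show ?thesis
  proof cases
    case 2
    then show ?thesis by (simp add: powr_diff)
  next
    case 3
    define T where "T = t powr p"
    have "0 < p" using p q zero_less_mult_pos2[of p "q - 1"] by simp
    then have T: "0 < T" "T < 1"
      using 3 \<open>0 < p\<close> powr_less_mono2[of p t 1] by (simp_all add: T_def)
    define e where "e n = (q gchoose n) * ((t ^ n + (- t) ^ n) / 2)" for n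
    define g where "g n = ((q - 1) gchoose n) * T ^ n" for n
    have "(\<lambda>n. ((q gchoose n) * t ^ n + (q gchoose n) * (- t) ^ n) / 2)
        sums (((1 + t) powr q + (1 + - t) powr q) / 2)"
      using 3 by (intro sums_divide sums_add gen_binomial_real) auto
    then have e: "e sums (((1 + t) powr q + (1 - t) powr q) / 2)"
      by (simp add: e_def[abs_def] distrib_left)
    have g: "g sums (1 + T) powr (q - 1)"
      unfolding g_def using T by (intro gen_binomial_real) auto
    have pairs: "(\<lambda>n. f (Suc (2 * n)) + f (Suc (Suc (2 * n)))) sums (s - f 0)"
      if "f sums s" for f :: "nat \<Rightarrow> real" and s
    proof -
      have "(\<lambda>n. f (Suc n)) sums (s - f 0)"
        using that by (simp add: sums_Suc_iff)
      from sums_group[OF this, of 2] show ?thesis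
        by (simp add: numeral_2_eq_2 mult.commute)
    qed
    have "(1 + T) powr (q - 1) - g 0 \<le> ((1 + t) powr q + (1 - t) powr q) / 2 - e 0"
    proof (rule sums_le[OF _ pairs[OF g] pairs[OF e]])
      fix n
      show "g (Suc (2 * n)) + g (Suc (Suc (2 * n))) \<le> e (Suc (2 * n)) + e (Suc (Suc (2 * n)))"
        using paired_terms_le[OF q p _ refl, of t n] 3 by (simp add: e_def g_def T_def)
    qed
    then show ?thesis by (simp add: e_def g_def T_def)
  qed auto
qed

text \<open>
  The homogeneous form is stated for the images \<open>x + y\<close> and \<open>x - y\<close>: the map
  \<open>(u, v) \<mapsto> (u + v, u - v)\<close> is an involution up to a factor \<open>2\<close>, so the previous inequality, which
  bounds the arguments by their sum and difference, also bounds the sum and difference by the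
  arguments.
\<close>

lemma scalar_clarkson:
  fixes p q x y :: real
  assumes q: "1 < q" "q \<le> 2" and p: "p * (q - 1) = q"
  shows "\<bar>x + y\<bar> powr p + \<bar>x - y\<bar> powr p \<le> 2 * (\<bar>x\<bar> powr q + \<bar>y\<bar> powr q) powr (p - 1)"
proof -
  have "0 < p" using p q zero_less_mult_pos2[of p "q - 1"] by simp
  have conj: "(q - 1) * (p - 1) = 1" "q * (p - 1) = p"
    using p by (auto simp: algebra_simps)
  have "1 \<le> p" using conj(1) q zero_less_mult_pos[of "q - 1" "p - 1"] by simp
  have main: "\<bar>u\<bar> powr p + \<bar>v\<bar> powr p \<le> ((\<bar>u + v\<bar> powr q + \<bar>u - v\<bar> powr q) / 2) powr (p - 1)"
    if uv: "\<bar>v\<bar> \<le> \<bar>u\<bar>" for u v :: real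
  proof (cases "u = 0")
    case False
    define t where "t = \<bar>v\<bar> / \<bar>u\<bar>"
    have t: "0 \<le> t" "t \<le> 1" and v: "\<bar>v\<bar> = \<bar>u\<bar> * t"
      using uv False by (auto simp: t_def)
    have "(1 + t powr p) = ((1 + t powr p) powr (q - 1)) powr (p - 1)"
      using conj by (simp add: powr_powr add_pos_nonneg)
    also have "\<dots> \<le> (((1 + t) powr q + (1 - t) powr q) / 2) powr (p - 1)"
      using \<open>1 \<le> p\<close> by (intro powr_mono2 clarkson_unit_interval q p t) auto
    finally have "\<bar>u\<bar> powr p * (1 + t powr p)
        \<le> (\<bar>u\<bar> powr q) powr (p - 1) * (((1 + t) powr q + (1 - t) powr q) / 2) powr (p - 1)"
      by (simp add: powr_powr conj mult_left_mono)
    also have "\<dots> = (\<bar>u\<bar> powr q * (((1 + t) powr q + (1 - t) powr q) / 2)) powr (p - 1)"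
      by (rule powr_mult[symmetric])
    also have "\<bar>u\<bar> powr q * (((1 + t) powr q + (1 - t) powr q) / 2)
        = ((\<bar>u\<bar> * (1 + t)) powr q + (\<bar>u\<bar> * (1 - t)) powr q) / 2"
      unfolding powr_mult by (simp add: distrib_left)
    also have "\<dots> = ((\<bar>u\<bar> + \<bar>v\<bar>) powr q + (\<bar>u\<bar> - \<bar>v\<bar>) powr q) / 2"
      by (simp add: v algebra_simps)
    also have "\<dots> = (\<bar>u + v\<bar> powr q + \<bar>u - v\<bar> powr q) / 2"
    proof -
      have "\<bar>u + v\<bar> = \<bar>u\<bar> + \<bar>v\<bar> \<and> \<bar>u - v\<bar> = \<bar>u\<bar> - \<bar>v\<bar> \<or>
            \<bar>u + v\<bar> = \<bar>u\<bar> - \<bar>v\<bar> \<and> \<bar>u - v\<bar> = \<bar>u\<bar> + \<bar>v\<bar>"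
        using uv by linarith
      then show ?thesis
        by (elim disjE conjE) (simp_all only: add.commute)
    qed
    also have "\<bar>u\<bar> powr p * (1 + t powr p) = \<bar>u\<bar> powr p + \<bar>v\<bar> powr p"
      using t by (simp add: v powr_mult algebra_simps)
    finally show ?thesis .
  qed (use uv in auto)
  have "\<bar>u\<bar> powr p + \<bar>v\<bar> powr p \<le> ((\<bar>u + v\<bar> powr q + \<bar>u - v\<bar> powr q) / 2) powr (p - 1)" for u v
  proof (cases "\<bar>v\<bar> \<le> \<bar>u\<bar>")
    case False
    then have "\<bar>u\<bar> \<le> \<bar>v\<bar>" by simp
    from main[OF this] show ?thesis
      by (simp only: ac_simps abs_minus_commute[of v u])
  qed (rule main)
  from this[of "x + y" "x - y"]
  have "\<bar>x + y\<bar> powr p + \<bar>x - y\<bar> powr p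
      \<le> ((\<bar>2 * x\<bar> powr q + \<bar>2 * y\<bar> powr q) / 2) powr (p - 1)"
    by simp
  also have "(\<bar>2 * x\<bar> powr q + \<bar>2 * y\<bar> powr q) / 2 = 2 powr (q - 1) * (\<bar>x\<bar> powr q + \<bar>y\<bar> powr q)"
    by (simp add: abs_mult powr_mult powr_diff algebra_simps add_divide_distrib)
  also have "\<dots> powr (p - 1) = 2 * (\<bar>x\<bar> powr q + \<bar>y\<bar> powr q) powr (p - 1)"
    using conj by (simp add: powr_mult powr_powr)
  finally show ?thesis .
qed

section \<open>Enflo's inequality in sequence spaces\<close>

lemma lp_space_sums:
  assumes "1 \<le> p" "x \<in> lp_space p"
  shows "(\<lambda>n. \<bar>x n\<bar> powr p) sums (lp_norm p x powr p)"
  using assms by (simp add: lp_norm_powr lp_space_def summable_sums)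

lemma lp_enflo_le_2:
  assumes p: "1 \<le> p" "p \<le> 2" and x: "x \<in> lp_space p" and y: "y \<in> lp_space p"
  shows "lp_norm p (\<lambda>n. x n + y n) powr p + lp_norm p (\<lambda>n. x n - y n) powr p
    \<le> 2 * (lp_norm p x powr p + lp_norm p y powr p)"
proof (rule sums_le)
  show "(\<lambda>n. \<bar>x n + y n\<bar> powr p + \<bar>x n - y n\<bar> powr p) sums
      (lp_norm p (\<lambda>n. x n + y n) powr p + lp_norm p (\<lambda>n. x n - y n) powr p)"
    using p x y by (intro sums_add lp_space_sums lp_space_add(1) lp_space_diff)
  show "(\<lambda>n. 2 * (\<bar>x n\<bar> powr p + \<bar>y n\<bar> powr p)) sums
      (2 * (lp_norm p x powr p + lp_norm p y powr p))"
    using p x y by (intro sums_mult sums_add lp_space_sums)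
qed (rule scalar_enflo[OF p])

text \<open>
  Clarkson's scalar inequality has the outer exponent \<open>p - 1 \<ge> 1\<close>, so summation over the coordinates
  leads to the norm of \<open>\<bar>x n\<bar>\<^sup>q + \<bar>y n\<bar>\<^sup>q\<close> in the sequence space of exponent \<open>p - 1\<close>.  Minkowski's inequality
  splits it, and since \<open>q (p - 1) = p\<close> the two parts are \<open>q\<close>-th powers of norms in \<open>\<ell>\<^sup>p\<close>.  The
  result bounds the mean of order \<open>p\<close> of the norms of \<open>x + y\<close> and \<open>x - y\<close>, hence that of order
  \<open>q \<le> p\<close>.
\<close>

lemma lp_enflo_ge_2:
  assumes p: "2 \<le> p" and x: "x \<in> lp_space p" and y: "y \<in> lp_space p"
  defines "q \<equiv> p / (p - 1)"
  shows "lp_norm p (\<lambda>n. x n + y n) powr q + lp_norm p (\<lambda>n. x n - y n) powr q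
    \<le> 2 * (lp_norm p x powr q + lp_norm p y powr q)"
proof -
  have p1: "1 \<le> p" "1 \<le> p - 1" using p by auto
  have q: "1 < q" "q \<le> 2" "q \<le> p" "p * (q - 1) = q" and conj: "q * (p - 1) = p"
    using p unfolding q_def by (auto simp: field_simps mult_left_mono)
  have powers: "(\<lambda>n. \<bar>z n\<bar> powr q) \<in> lp_space (p - 1)"
    "lp_norm (p - 1) (\<lambda>n. \<bar>z n\<bar> powr q) = lp_norm p z powr q" if "z \<in> lp_space p" for z
    using that p1 by (simp_all add: lp_space_def lp_norm_def powr_powr conj q_def)
  define X Y where "X n = \<bar>x n\<bar> powr q" and "Y n = \<bar>y n\<bar> powr q" for n
  have X: "X \<in> lp_space (p - 1)" "lp_norm (p - 1) X = lp_norm p x powr q"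
    and Y: "Y \<in> lp_space (p - 1)" "lp_norm (p - 1) Y = lp_norm p y powr q"
    using powers[OF x] powers[OF y] unfolding X_def Y_def by auto
  let ?u = "lp_norm p (\<lambda>n. x n + y n)" and ?v = "lp_norm p (\<lambda>n. x n - y n)"
  let ?S = "lp_norm p x powr q + lp_norm p y powr q"
  have "?u powr p + ?v powr p \<le> 2 * lp_norm (p - 1) (\<lambda>n. X n + Y n) powr (p - 1)"
  proof (rule sums_le)
    show "(\<lambda>n. \<bar>x n + y n\<bar> powr p + \<bar>x n - y n\<bar> powr p) sums (?u powr p + ?v powr p)"
      using p1 x y by (intro sums_add lp_space_sums lp_space_add(1) lp_space_diff)
    show "(\<lambda>n. 2 * \<bar>X n + Y n\<bar> powr (p - 1)) sums
        (2 * lp_norm (p - 1) (\<lambda>n. X n + Y n) powr (p - 1))"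
      using p1 X Y by (intro sums_mult lp_space_sums lp_space_add(1))
    show "\<bar>x n + y n\<bar> powr p + \<bar>x n - y n\<bar> powr p \<le> 2 * \<bar>X n + Y n\<bar> powr (p - 1)" for n
      using scalar_clarkson[OF q(1,2,4), of "x n" "y n"] by (simp add: X_def Y_def)
  qed
  also have "\<dots> \<le> 2 * ?S powr (p - 1)"
    using lp_space_add(2)[OF p1(2) X(1) Y(1)] p1 X(2) Y(2)
    by (intro mult_left_mono powr_mono2) (auto simp: lp_norm_nonneg)
  finally have clarkson: "(?u powr p + ?v powr p) / 2 \<le> ?S powr (p - 1)"
    by simp
  have "(?u powr q + ?v powr q) / 2 \<le> ((?u powr p + ?v powr p) / 2) powr (q / p)"
    using q by (intro power_mean_le) (auto simp: lp_norm_nonneg)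
  also have "\<dots> \<le> (?S powr (p - 1)) powr (q / p)"
    using clarkson q p by (intro powr_mono2) auto
  also have "\<dots> = ?S"
    using conj p by (simp add: powr_powr mult.commute)
  finally show ?thesis by simp
qed

text \<open>
  With \<open>c\<close> the midpoint of \<open>a1\<close> and \<open>a2\<close>, the two-vector inequality for \<open>a1 - b\<close> and \<open>a2 - b\<close>
  bounds the power of \<open>d(a1, a2)\<close> together with that of \<open>2 d(c, b)\<close>, for each of \<open>b = b1\<close>
  and \<open>b = b2\<close>.  Convexity of the power of the norm bounds that of \<open>d(b1, b2)\<close> by
  the mean of those of \<open>2 d(c, b1)\<close> and \<open>2 d(c, b2)\<close>.
\<close>

lemma has_roundness_lpI:
  assumes p: "1 \<le> p" and q: "1 \<le> q"
    and enflo: "\<And>x y. x \<in> lp_space p \<Longrightarrow> y \<in> lp_space p \<Longrightarrow>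
      lp_norm p (\<lambda>n. x n + y n) powr q + lp_norm p (\<lambda>n. x n - y n) powr q
        \<le> 2 * (lp_norm p x powr q + lp_norm p y powr q)"
  shows "has_roundness (lp_metric p) q"
  unfolding has_roundness_def mspace_lp_metric[OF p] mdist_lp_metric[OF p]
proof (intro conjI ballI q)
  fix a1 a2 b1 b2 :: "nat \<Rightarrow> real"
  assume mem: "a1 \<in> lp_space p" "a2 \<in> lp_space p" "b1 \<in> lp_space p" "b2 \<in> lp_space p"
  define d where "d x y = lp_norm p (\<lambda>n. x n - y n)" for x y
  define M where "M b = (\<lambda>n. (a1 n - b n) + (a2 n - b n))" for b
  have M: "M b \<in> lp_space p" if "b \<in> lp_space p" for b
    unfolding M_def using p that mem by (intro lp_space_add(1) lp_space_diff)
  have half: "lp_norm p (M b) powr q + d a1 a2 powr q \<le> 2 * (d a1 b powr q + d a2 b powr q)"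
    if "b \<in> lp_space p" for b
    using enflo[OF lp_space_diff[OF p mem(1) that] lp_space_diff[OF p mem(2) that]]
    by (simp add: M_def d_def)
  have "2 * d b1 b2 \<le> lp_norm p (M b1) + lp_norm p (M b2)"
  proof -
    have "lp_norm p (\<lambda>n. M b2 n + - M b1 n) \<le> lp_norm p (M b2) + lp_norm p (\<lambda>n. - M b1 n)"
      using lp_space_add(2)[OF p M[OF mem(4)], of "\<lambda>n. - M b1 n"] M[OF mem(3)]
      by (simp add: lp_space_def)
    also have "(\<lambda>n. M b2 n + - M b1 n) = (\<lambda>n. 2 * (b1 n - b2 n))"
      by (auto simp: M_def)
    also have "lp_norm p (\<lambda>n. 2 * (b1 n - b2 n)) = 2 * d b1 b2"
    proof -
      have "lp_norm p (\<lambda>n. 2 * (b1 n - b2 n)) = (\<Sum>n. 2 powr p * \<bar>b1 n - b2 n\<bar> powr p) powr (1 / p)"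
        by (simp add: lp_norm_def abs_mult powr_mult del: right_diff_distrib_numeral)
      also have "\<dots> = (2 powr p * (\<Sum>n. \<bar>b1 n - b2 n\<bar> powr p)) powr (1 / p)"
        using lp_space_diff[OF p mem(3,4)] by (subst suminf_mult) (auto simp: lp_space_def)
      also have "\<dots> = 2 * d b1 b2"
        using p by (simp add: d_def lp_norm_def powr_mult powr_powr)
      finally show ?thesis .
    qed
    finally show ?thesis by (simp add: lp_norm_def)
  qed
  then have "d b1 b2 powr q \<le> (1/2 * lp_norm p (M b1) + 1/2 * lp_norm p (M b2)) powr q"
    using q by (intro powr_mono2) (auto simp: d_def lp_norm_nonneg)
  also have "\<dots> \<le> 1/2 * lp_norm p (M b1) powr q + 1/2 * lp_norm p (M b2) powr q"
    using q by (intro powr_convex_nonneg) (auto simp: lp_norm_nonneg)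
  finally have "2 * d b1 b2 powr q \<le> lp_norm p (M b1) powr q + lp_norm p (M b2) powr q"
    by simp
  then have "d a1 a2 powr q + d b1 b2 powr q
      \<le> d a1 b1 powr q + d a1 b2 powr q + d a2 b1 powr q + d a2 b2 powr q"
    using half[OF mem(3)] half[OF mem(4)] by argo
  then show "lp_norm p (\<lambda>n. a1 n - a2 n) powr q + lp_norm p (\<lambda>n. b1 n - b2 n) powr q
      \<le> lp_norm p (\<lambda>n. a1 n - b1 n) powr q + lp_norm p (\<lambda>n. a1 n - b2 n) powr q
        + lp_norm p (\<lambda>n. a2 n - b1 n) powr q + lp_norm p (\<lambda>n. a2 n - b2 n) powr q"
    by (simp only: d_def)
qed

section \<open>Squares in the coordinate plane\<close>

definition plane_point :: "real \<Rightarrow> real \<Rightarrow> nat \<Rightarrow> real" where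
  "plane_point a b n = (if n = 0 then a else if n = 1 then b else 0)"

lemma plane_point_diff:
  "(\<lambda>n. plane_point a b n - plane_point c d n) = plane_point (a - c) (b - d)"
  by (auto simp: plane_point_def)

lemma plane_point_sums: "(\<lambda>n. \<bar>plane_point a b n\<bar> powr p) sums (\<bar>a\<bar> powr p + \<bar>b\<bar> powr p)"
proof -
  have "(\<lambda>n. \<bar>plane_point a b n\<bar> powr p) sums (\<Sum>n\<in>{0, 1}. \<bar>plane_point a b n\<bar> powr p)"
    by (rule sums_finite) (auto simp: plane_point_def)
  then show ?thesis by (simp add: plane_point_def)
qed

lemma plane_point_in_lp_space: "plane_point a b \<in> lp_space p"
  using plane_point_sums[of a b p] by (auto simp: lp_space_def sums_iff)

lemma lp_norm_plane_point:
  "lp_norm p (plane_point a b) = (\<bar>a\<bar> powr p + \<bar>b\<bar> powr p) powr (1 / p)"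
  using plane_point_sums[of a b p] by (simp add: lp_norm_def sums_iff)

text \<open>
  The unit square with diagonals from \<open>(0, 0)\<close> to \<open>(1, 1)\<close> and from \<open>(1, 0)\<close> to \<open>(0, 1)\<close>: its sides
  have length \<open>1\<close> and its diagonals \<open>2\<close> to the power \<open>1 / p\<close>.
\<close>

lemma roundness_lp_le:
  assumes p: "1 \<le> p" and r: "has_roundness (lp_metric p) q"
  shows "q \<le> p"
proof -
  let ?d = "mdist (lp_metric p)"
  let ?a1 = "plane_point 0 0" and ?a2 = "plane_point 1 1"
    and ?b1 = "plane_point 1 0" and ?b2 = "plane_point 0 1"
  have "?d ?a1 ?a2 powr q + ?d ?b1 ?b2 powr q
      \<le> ?d ?a1 ?b1 powr q + ?d ?a1 ?b2 powr q + ?d ?a2 ?b1 powr q + ?d ?a2 ?b2 powr q"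
    using r p unfolding has_roundness_def by (simp add: plane_point_in_lp_space)
  then have "2 powr (q / p) \<le> (2 powr 1 :: real)"
    using p by (simp add: plane_point_diff lp_norm_plane_point powr_powr)
  then have "q / p \<le> 1"
    by (subst (asm) powr_le_cancel_iff) auto
  then show ?thesis using p by simp
qed

text \<open>
  The square with diagonals from \<open>(0, 0)\<close> to \<open>(2, 0)\<close> and from \<open>(1, 1)\<close> to \<open>(1, -1)\<close>: now the
  diagonals have length \<open>2\<close>, and the sides have length \<open>2\<close> to the power \<open>1 / p\<close>.
\<close>

lemma roundness_lp_le_conjugate:
  assumes p: "1 < p" and r: "has_roundness (lp_metric p) q"
  shows "q \<le> p / (p - 1)"
proof -
  let ?d = "mdist (lp_metric p)"
  let ?a1 = "plane_point 0 0" and ?a2 = "plane_point 2 0"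
    and ?b1 = "plane_point 1 1" and ?b2 = "plane_point 1 (-1)"
  have "?d ?a1 ?a2 powr q + ?d ?b1 ?b2 powr q
      \<le> ?d ?a1 ?b1 powr q + ?d ?a1 ?b2 powr q + ?d ?a2 ?b1 powr q + ?d ?a2 ?b2 powr q"
    using r p unfolding has_roundness_def by (simp add: plane_point_in_lp_space)
  then have "2 * 2 powr q \<le> (4 * 2 powr (q / p) :: real)"
    using p by (simp add: plane_point_diff lp_norm_plane_point powr_powr)
  then have "2 powr q \<le> (2 powr (1 + q / p) :: real)"
    by (simp add: powr_add)
  then have "q \<le> 1 + q / p"
    by (subst (asm) powr_le_cancel_iff) auto
  then show ?thesis using p by (simp add: field_simps)
qed

theorem corollary3p6:
  fixes p :: real
  assumes "1 \<le> p"
  shows "maximal_roundness (lp_metric p) = min (ereal p) (conjugate_index p)"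
proof -
  define m where "m = (if p \<le> 2 then p else p / (p - 1))"
  have m: "min (ereal p) (conjugate_index p) = ereal m"
  proof -
    have "p \<le> p / (p - 1) \<longleftrightarrow> p \<le> 2" if "1 < p"
      using that by (simp add: field_simps)
    then show ?thesis
      using assms by (auto simp: conjugate_index_def m_def min_def)
  qed
  have attained: "has_roundness (lp_metric p) m"
    using assms lp_enflo_le_2 lp_enflo_ge_2
    by (intro has_roundness_lpI) (auto simp: m_def)
  have bound: "q \<le> m" if "has_roundness (lp_metric p) q" for q
    using roundness_lp_le[OF assms that] roundness_lp_le_conjugate[OF _ that] assms
    by (auto simp: m_def)
  show ?thesis
    unfolding maximal_roundness_def m
    by (rule Sup_eqI) (use attained bound in auto)
qed

end
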